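(* Let $\tau=\overline{*12^{N-2}}$ (with $\tau_0=*$, of period $N$), and let $l\in\{1,2,\ldots,N-2\}$. Let $$e=\overline{12^{N-3}1}\,12^{N-2}1,\qquad \widetilde{e}=\overline{12^{N-3}1}\,12^{N-2}12^{l}.$$ Then there exist asymptotic rays $\Phi$ and $\Phi'$ in $\hat{D}_\tau$ such that $\Phi$ originates in $T(e)$ and $\Phi'$ originates in $T(\widetilde{e})$.
   Context: Symbols and topology: $\{*,1,2\}$ has the topology with basis $\{\{1\},\{2\},\{*,1,2\}\}$; products carry the product topology and subsets the subspace topology. One-sided sequences are indexed $x=x_0x_1x_2\ldots$. For $a,b\in\{*,1,2\}$, $a\approx b$ means $a=b$ or at least one of $a,b$ is $*$; for (finite or infinite) sequences, $\approx$ is meant termwise. $\sigma$ is the shift $x_0x_1x_2\ldots\mapsto x_1x_2\ldots$. An exponent on a symbol denotes repetition. For a finite word $w$, $\overline{w}$ denotes infinite repetition of $w$: to the right for $\tau$, and to the left for sequences indexed by negative integers (so $\overline{w}\,v=\ldots www\,v$, the last letter of $v$ having index $-1$). $D_\tau$ is the set of all $\tau$-admissible sequences: $x\in\{*,1,2\}^{\{0,1,2,\ldots\}}$ such that for every $n\ge 0$, $x_n=*$ implies $\sigma^n x=\tau$, and $\sigma^n x\approx\tau$ implies $\sigma^n x=\tau$. It is a known fact that $D_\tau$ is a dendrite. For $\hat{x}=(\hat x_i)_{i\in\mathbb{Z}}\in\{*,1,2\}^{\mathbb{Z}}$ put $\pi_n(\hat{x})=\hat{x}_n\hat{x}_{n+1}\hat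 x_{n+2}\ldots$, and let $\hat{D}_\tau=\{\hat{x}:\pi_n(\hat{x})\in D_\tau\text{ for all }n\in\mathbb{Z}\}$; it is a compact metrizable space, homeomorphic to the inverse limit of $D_\tau$ with bonding map $\sigma$. For a sequence $e=\ldots e_{-3}e_{-2}e_{-1}$, $T(e)=\{\hat{y}\in\hat{D}_\tau:\hat{y}_i\approx e_i\text{ for all }i\le -1\}$. A ray is the image of a continuous injection $\phi:[0,\infty)\to\hat{D}_\tau$ (a continuous bijection onto its image); $\phi$ is called a parameterization, and the ray originates in $T(e)$ if $\phi(0)\in T(e)$. Two rays $\Phi,\Phi'$ are asymptotic if they admit parameterizations $\phi,\phi'$ (starting at their origins) with $d(\phi(s),\phi'(s))\to 0$ as $s\to\infty$, where $d$ is a metric compatible with the topology of $\hat{D}_\tau$. *)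

theory Defs
  imports "HOL-Analysis.Analysis"
begin

datatype symb = Star | One | Two

instantiation symb :: topological_space
begin

definition open_symb :: "symb set \<Rightarrow> bool" where
  "open_symb = generate_topology {{One}, {Two}, {Star, One, Two}}"

instance
proof
  have "(UNIV :: symb set) = {Star, One, Two}"
    using symb.exhaust by blast
  moreover have "generate_topology {{One}, {Two}, {Star, One, Two}} {Star, One, Two}"
    by (rule generate_topology.Basis) simp
  ultimately show "open (UNIV :: symb set)"
    by (simp only: open_symb_def)
next
  fix S U :: "symb set"
  assume "open S" "open U"
  then show "open (S \<inter> U)"
    unfolding open_symb_def by (rule generate_topology.Int)
next
  fix K :: "symb set set"
  assume "\<forall>S\<in>K. open S"
  then show "open (\<Union> K)"
    unfolding open_symb_def by (intro generate_topology.UN) blast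
qed

end

definition compat :: "symb \<Rightarrow> symb \<Rightarrow> bool" (infix "\<approx>\<^sub>s" 50) where
  "a \<approx>\<^sub>s b \<longleftrightarrow> a = b \<or> a = Star \<or> b = Star"

definition seq_compat :: "(nat \<Rightarrow> symb) \<Rightarrow> (nat \<Rightarrow> symb) \<Rightarrow> bool" where
  "seq_compat x y \<longleftrightarrow> (\<forall>i. x i \<approx>\<^sub>s y i)"

definition shift :: "(nat \<Rightarrow> symb) \<Rightarrow> nat \<Rightarrow> symb" where
  "shift x = (\<lambda>i. x (Suc i))"

definition D :: "(nat \<Rightarrow> symb) \<Rightarrow> (nat \<Rightarrow> symb) set" where
  "D \<tau> = {x. \<forall>n. (x n = Star \<longrightarrow> (shift ^^ n) x = \<tau>) \<and>
                 (seq_compat ((shift ^^ n) x) \<tau> \<longrightarrow> (shift ^^ n) x = \<tau>)}"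

definition proj_from :: "int \<Rightarrow> (int \<Rightarrow> symb) \<Rightarrow> nat \<Rightarrow> symb" where
  "proj_from n x = (\<lambda>i. x (n + int i))"

text \<open>The type \<^typ>\<open>int \<Rightarrow> symb\<close> carries the library's product topology, which is not
  Hausdorff; topological statements about \<open>Dhat \<tau>\<close> refer to the subspace topology.\<close>

definition Dhat :: "(nat \<Rightarrow> symb) \<Rightarrow> (int \<Rightarrow> symb) set" where
  "Dhat \<tau> = {x. \<forall>n. proj_from n x \<in> D \<tau>}"

definition right_periodic :: "symb list \<Rightarrow> nat \<Rightarrow> symb" where
  "right_periodic w n = w ! (n mod length w)"

text \<open>The sequence \<open>\<dots>wwwv\<close> whose last letter has index \<open>-1\<close>. Sequences indexed by the
  negative integers are represented as functions on all integers; the values at indices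
  \<open>\<ge> 0\<close> are junk and are never used.\<close>

definition left_periodic :: "symb list \<Rightarrow> symb list \<Rightarrow> int \<Rightarrow> symb" where
  "left_periodic w v i =
     (let k = nat (- 1 - i)
      in if k < length v then rev v ! k
         else rev w ! ((k - length v) mod length w))"

definition T :: "(nat \<Rightarrow> symb) \<Rightarrow> (int \<Rightarrow> symb) \<Rightarrow> (int \<Rightarrow> symb) set" where
  "T \<tau> e = {y \<in> Dhat \<tau>. \<forall>i \<le> - 1. y i \<approx>\<^sub>s e i}"

definition compatible_metric ::
    "(nat \<Rightarrow> symb) \<Rightarrow> ((int \<Rightarrow> symb) \<Rightarrow> (int \<Rightarrow> symb) \<Rightarrow> real) \<Rightarrow> bool" where
  "compatible_metric \<tau> d \<longleftrightarrow>
     Metric_space (Dhat \<tau>) d \<and> Metric_space.mtopology (Dhat \<tau>) d = top_of_set (Dhat \<tau>)"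

text \<open>A ray is a subset of \<open>Dhat \<tau>\<close>; its origin \<open>p\<close> is recorded explicitly, so that the
  parameterizations compared in \<open>asymptotic\<close> start at the same points as those witnessing
  where the rays originate.\<close>

definition parameterization ::
    "(nat \<Rightarrow> symb) \<Rightarrow> (int \<Rightarrow> symb) set \<Rightarrow> (int \<Rightarrow> symb) \<Rightarrow> (real \<Rightarrow> int \<Rightarrow> symb) \<Rightarrow> bool" where
  "parameterization \<tau> \<Phi> p \<phi> \<longleftrightarrow>
     continuous_on {0..} \<phi> \<and> inj_on \<phi> {0..} \<and> \<phi> ` {0..} = \<Phi> \<and> \<Phi> \<subseteq> Dhat \<tau> \<and> \<phi> 0 = p"

definition ray :: "(nat \<Rightarrow> symb) \<Rightarrow> (int \<Rightarrow> symb) set \<Rightarrow> (int \<Rightarrow> symb) \<Rightarrow> bool" where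
  "ray \<tau> \<Phi> p \<longleftrightarrow> (\<exists>\<phi>. parameterization \<tau> \<Phi> p \<phi>)"

definition asymptotic ::
    "(nat \<Rightarrow> symb) \<Rightarrow> ((int \<Rightarrow> symb) \<Rightarrow> (int \<Rightarrow> symb) \<Rightarrow> real) \<Rightarrow>
     (int \<Rightarrow> symb) set \<Rightarrow> (int \<Rightarrow> symb) \<Rightarrow> (int \<Rightarrow> symb) set \<Rightarrow> (int \<Rightarrow> symb) \<Rightarrow> bool" where
  "asymptotic \<tau> d \<Phi> p \<Phi>' p' \<longleftrightarrow>
     (\<exists>\<phi> \<phi>'. parameterization \<tau> \<Phi> p \<phi> \<and> parameterization \<tau> \<Phi>' p' \<phi>' \<and>
             ((\<lambda>s. d (\<phi> s) (\<phi>' s)) \<longlongrightarrow> 0) at_top)"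

end

theory Submission
  imports Defs
begin

text \<open>
  The sequence \<open>\<tau>\<close> is the itinerary of the critical point of a unimodal map of an interval, so the
  two rays can be found inside the inverse limit of that interval, where they are explicit.

  Put \<open>m = N - 1\<close> and let \<open>\<lambda> < 2\<close> be the \<open>m\<close>-bonacci number, \<open>\<lambda>\<^sup>m (2 - \<lambda>) = 1\<close>. The tent map
  \<open>x \<mapsto> \<lambda> - 1 - \<lambda>\<bar>x\<bar>\<close> on \<open>[-1, 1]\<close> has critical point \<open>0\<close>, which is periodic of period \<open>N\<close> with
  itinerary \<open>\<tau>\<close> (\<open>itinerary_0\<close>) when positive points are coded by \<open>One\<close>, negative points by \<open>Two\<close>
  and \<open>0\<close> by \<open>Star\<close>. Two codes are compatible exactly if the points do not lie strictly on different
  sides of \<open>0\<close>, and then the tent map expands their distance by the factor \<open>\<lambda>\<close>. Hence points with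
  compatible itineraries are equal, so that coding maps the two-sided orbits of the tent map
  continuously and injectively into \<open>Dhat \<tau>\<close>.

  The word \<open>w = 1 2\<^sup>N\<^sup>-\<^sup>3 1\<close> describes a periodic orbit of period \<open>m\<close>, and along one side of each of
  its points the inverse limit contains a ray: the unstable ray \<open>F\<^sub>j\<close>, with
  \<open>tent (F\<^sub>j s) = F\<^sub>j\<^sub>+\<^sub>1 (\<lambda> s)\<close> and \<open>j\<close> taken modulo \<open>m\<close>. On \<open>[0, 1]\<close> every \<open>F\<^sub>j\<close> is piecewise linear
  with a single turning point, and on \<open>[1, \<lambda>]\<close> all of them coincide with \<open>s - 1\<close>. By the functional
  equation they coincide on \<open>[1, \<infinity>)\<close> (\<open>unstable_agree\<close>). Shifting by \<open>l\<close> gives rays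
  \<open>u\<^sub>i(t) = F\<^sub>i\<^sub>+\<^sub>1\<^sub>+\<^sub>l (\<lambda>\<^sup>i\<^sup>+\<^sup>1 (1 + t))\<close>. For different \<open>l\<close> each coordinate eventually agrees exactly, and
  compactness of the space of orbits turns this into convergence to \<open>0\<close> in any compatible metric
  (\<open>code_asymptotic_of_coordinates_eventually_eq\<close>). At \<open>t = 0\<close> the signs of the \<open>F\<^sub>j\<close> show that
  the ray with parameter \<open>l\<close> originates over the left tail \<open>\<dots>www 1 2\<^sup>N\<^sup>-\<^sup>2 1 2\<^sup>l\<close>
  (\<open>orbit_ray_origin\<close>); \<open>l = 0\<close> is \<open>e\<close>, and the given \<open>l\<close> is \<open>e'\<close>.
\<close>

section \<open>Coding points of the line\<close>

definition code :: "real \<Rightarrow> symb" where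
  "code x = (if x = 0 then Star else if x > 0 then One else Two)"

text \<open>The symbolic relation becomes the sign condition under which a tent map expands.\<close>
lemma compat_code_iff: "code x \<approx>\<^sub>s code y \<longleftrightarrow> 0 \<le> x * y"
  by (auto simp: compat_def code_def zero_le_mult_iff)

lemma compat_code_One: "0 \<le> x \<Longrightarrow> code x \<approx>\<^sub>s One"
  and compat_code_Two: "x \<le> 0 \<Longrightarrow> code x \<approx>\<^sub>s Two"
  by (auto simp: compat_def code_def)

lemma continuous_on_code: "continuous_on UNIV code"
proof -
  have "open (code -` U)" if "generate_topology {{One}, {Two}, {Star, One, Two}} U" for U
    using that
  proof (induction rule: generate_topology.induct)
    case UNIV
    show ?case by simp
  next
    case (Int a b)
    then show ?case by (simp add: vimage_Int open_Int)
  next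
    case (UN K)
    then show ?case by (auto simp: vimage_Union)
  next
    case (Basis s)
    have "code -` {One} = {0<..}" "code -` {Two} = {..<0}" "code -` {Star, One, Two} = UNIV"
      by (auto simp: code_def split: if_splits)
    with Basis show ?case by auto
  qed
  then show ?thesis
    by (simp add: continuous_on_open_vimage open_symb_def)
qed

section \<open>The tent map with critical itinerary \<open>\<tau>\<close>\<close>

text \<open>The bound \<open>3/2\<close> gives \<open>\<lambda>\<^sup>2 \<ge> 2\<close>, on which the constant sign in \<open>bump_pos\<close> rests.\<close>
lemma exists_multinacci_slope:
  assumes "2 \<le> m"
  obtains lam :: real where "3/2 \<le> lam" "lam < 2" "lam ^ m * (2 - lam) = 1"
proof -
  have "(9/4 :: real) = (3/2) ^ 2" by (simp add: power2_eq_square)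
  also have "\<dots> \<le> (3/2) ^ m" using assms by (intro power_increasing) auto
  finally have "(1::real) \<le> (3/2) ^ m * (2 - 3/2)" by simp
  then have "\<exists>x\<ge>3/2. x \<le> 2 \<and> x ^ m * (2 - x) = (1::real)"
    by (intro IVT2') (auto intro!: continuous_intros)
  then obtain x :: real where x: "3/2 \<le> x" "x \<le> 2" "x ^ m * (2 - x) = 1" by blast
  then have "x \<noteq> 2" by auto
  with x show ?thesis by (intro that) auto
qed

locale multinacci_tent =
  fixes m :: nat and lam :: real
  assumes m_ge: "2 \<le> m" and lam_ge: "3/2 \<le> lam" and lam_less: "lam < 2"
    and lam_root: "lam ^ m * (2 - lam) = 1"
begin

text \<open>The usual tent map \<open>x \<mapsto> 1 - \<lambda>\<bar>x\<bar>\<close> in coordinates scaled by \<open>\<lambda> - 1\<close>. With this scaling \<open>-1\<close>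
  is fixed, so distances to \<open>-1\<close> are multiplied by \<open>\<lambda>\<close> on the left branch.\<close>
definition tent :: "real \<Rightarrow> real" where
  "tent x = lam - 1 - lam * \<bar>x\<bar>"

definition itinerary :: "real \<Rightarrow> nat \<Rightarrow> symb" where
  "itinerary x n = code ((tent ^^ n) x)"

lemma lam_pos: "0 < lam" and lam_gt_1: "1 < lam"
  using lam_ge by auto

lemma two_minus_lam: "2 - lam = 1 / lam ^ m"
  using lam_root lam_pos by (simp add: field_simps)

lemma tent_in_interval: "\<bar>x\<bar> \<le> 1 \<Longrightarrow> \<bar>tent x\<bar> \<le> 1"
proof -
  assume "\<bar>x\<bar> \<le> 1"
  then have "lam * \<bar>x\<bar> \<le> lam" "0 \<le> lam * \<bar>x\<bar>"
    using lam_pos by (auto simp: mult_left_le)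
  then show ?thesis
    using lam_less unfolding tent_def by linarith
qed

lemma tent_funpow_in_interval: "\<bar>x\<bar> \<le> 1 \<Longrightarrow> \<bar>(tent ^^ n) x\<bar> \<le> 1"
  by (induction n) (auto intro: tent_in_interval)

lemma tent_expands:
  assumes "0 \<le> x * y"
  shows "\<bar>tent x - tent y\<bar> = lam * \<bar>x - y\<bar>"
proof -
  have "tent x - tent y = lam * (\<bar>y\<bar> - \<bar>x\<bar>)"
    by (simp add: tent_def algebra_simps)
  moreover have "\<bar>\<bar>y\<bar> - \<bar>x\<bar>\<bar> = \<bar>x - y\<bar>"
    using assms by (auto simp: zero_le_mult_iff)
  ultimately show ?thesis
    using lam_pos by (simp add: abs_mult)
qed

text \<open>Compatible itineraries keep the two orbits on the same side of \<open>0\<close>, so their distance grows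
  like \<open>\<lambda>\<^sup>n\<close>, which is impossible in a bounded interval unless it is \<open>0\<close>. This single fact gives
  both admissibility and injectivity of the coding.\<close>
lemma itinerary_compat_imp_eq:
  assumes "seq_compat (itinerary x) (itinerary y)" "\<bar>x\<bar> \<le> 1" "\<bar>y\<bar> \<le> 1"
  shows "x = y"
proof (rule ccontr)
  assume "x \<noteq> y"
  have expand: "\<bar>(tent ^^ n) x - (tent ^^ n) y\<bar> = lam ^ n * \<bar>x - y\<bar>" for n
  proof (induction n)
    case (Suc n)
    have "0 \<le> (tent ^^ n) x * (tent ^^ n) y"
      using assms(1) by (simp add: seq_compat_def itinerary_def compat_code_iff)
    then show ?case by (simp add: tent_expands Suc.IH)
  qed simp
  obtain n where "2 / \<bar>x - y\<bar> < lam ^ n"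
    using real_arch_pow[OF lam_gt_1] by blast
  then have "2 < lam ^ n * \<bar>x - y\<bar>"
    using \<open>x \<noteq> y\<close> by (simp add: field_simps)
  with expand[of n] show False
    using tent_funpow_in_interval[OF assms(2), of n] tent_funpow_in_interval[OF assms(3), of n]
    by linarith
qed

lemma shift_funpow_itinerary: "(shift ^^ n) (itinerary x) = itinerary ((tent ^^ n) x)"
proof -
  have "shift (itinerary y) = itinerary (tent y)" for y
    by (simp add: shift_def itinerary_def fun_eq_iff funpow_swap1)
  then show ?thesis by (induction n) auto
qed

lemma itinerary_in_D: "\<bar>x\<bar> \<le> 1 \<Longrightarrow> itinerary x \<in> D (itinerary 0)"
proof -
  assume x: "\<bar>x\<bar> \<le> 1"
  have "itinerary ((tent ^^ n) x) = itinerary 0" if "itinerary x n = Star" for n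
    using that by (simp add: itinerary_def[of x] code_def split: if_splits)
  moreover have "itinerary ((tent ^^ n) x) = itinerary 0"
    if "seq_compat (itinerary ((tent ^^ n) x)) (itinerary 0)" for n
    using itinerary_compat_imp_eq[OF that] tent_funpow_in_interval[OF x] by simp
  ultimately show ?thesis
    unfolding D_def mem_Collect_eq shift_funpow_itinerary by blast
qed

text \<open>The critical value is mapped to \<open>\<lambda>(2 - \<lambda>) - 1\<close>, at distance \<open>\<lambda>\<^sup>1\<^sup>-\<^sup>m\<close> from the fixed point
  \<open>-1\<close>; from there each step multiplies this distance by \<open>\<lambda>\<close> until the orbit returns to \<open>0\<close>.\<close>
lemma critical_orbit:
  "k < m \<Longrightarrow> (tent ^^ Suc (Suc k)) 0 = 1 / lam ^ (m - 1 - k) - 1"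
proof (induction k)
  case 0
  have "tent (tent 0) = lam * (2 - lam) - 1"
    using lam_gt_1 by (simp add: tent_def algebra_simps)
  also have "\<dots> = 1 / lam ^ (m - 1) - 1"
    using m_ge lam_pos unfolding two_minus_lam by (cases m) auto
  finally show ?case by simp
next
  case (Suc k)
  let ?q = "1 / lam ^ (m - 1 - k)"
  have "m - 1 - k = Suc (m - 1 - Suc k)" using Suc.prems by simp
  then have q: "lam * ?q = 1 / lam ^ (m - 1 - Suc k)"
    using lam_pos by (simp add: power_Suc)
  have "?q \<le> 1" using lam_gt_1 by simp
  then have "tent (?q - 1) = lam * ?q - 1"
    by (simp add: tent_def algebra_simps)
  then show ?case using Suc q by simp
qed

lemma itinerary_0: "itinerary 0 = right_periodic ([Star, One] @ replicate (m - 1) Two)"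
proof
  fix n
  have len: "length ([Star, One] @ replicate (m - 1) Two) = Suc m"
    using m_ge by simp
  have per: "(tent ^^ Suc m) 0 = 0"
    using critical_orbit[of "m - 1"] m_ge by simp
  define r where "r = n mod Suc m"
  have "r \<le> m" unfolding r_def by (simp add: less_Suc_eq_le[symmetric])
  have "(tent ^^ n) 0 = (tent ^^ r) 0"
    unfolding r_def using per by (rule funpow_mod_eq[symmetric])
  moreover have "code ((tent ^^ r) 0) = ([Star, One] @ replicate (m - 1) Two) ! r"
  proof -
    consider "r = 0" | "r = 1" | k where "r = Suc (Suc k)" by (metis One_nat_def not0_implies_Suc)
    then show ?thesis
    proof cases
      case 1
      then show ?thesis by (simp add: code_def)
    next
      case 2
      then show ?thesis using lam_gt_1 by (simp add: code_def tent_def)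
    next
      case 3
      with \<open>r \<le> m\<close> have k: "k < m - 1" by simp
      then have "1 < lam ^ (m - 1 - k)"
        using lam_gt_1 by (intro one_less_power) auto
      then have "1 / lam ^ (m - 1 - k) < 1" by simp
      moreover have "(tent ^^ r) 0 = 1 / lam ^ (m - 1 - k) - 1"
        using critical_orbit[of k] k 3 by simp
      ultimately have "code ((tent ^^ r) 0) = Two"
        by (auto simp: code_def)
      with 3 k show ?thesis by simp
    qed
  qed
  ultimately show "itinerary 0 n = right_periodic ([Star, One] @ replicate (m - 1) Two) n"
    unfolding itinerary_def right_periodic_def len r_def by simp
qed

section \<open>Two-sided orbits inside \<open>Dhat \<tau>\<close>\<close>

definition orbits :: "(int \<Rightarrow> real) set" where
  "orbits = {u. \<forall>i. \<bar>u i\<bar> \<le> 1 \<and> tent (u i) = u (i + 1)}"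

lemma orbits_funpow: "u \<in> orbits \<Longrightarrow> u (i + int n) = (tent ^^ n) (u i)"
proof (induction n)
  case (Suc n)
  have "tent (u (i + int n)) = u (i + int n + 1)"
    using Suc.prems by (simp add: orbits_def)
  also have "i + int n + 1 = i + int (Suc n)" by simp
  finally have "u (i + int (Suc n)) = tent (u (i + int n))" ..
  then show ?case using Suc by simp
qed simp

lemma proj_from_code_orbit: "u \<in> orbits \<Longrightarrow> proj_from n (code \<circ> u) = itinerary (u n)"
  by (simp add: proj_from_def itinerary_def orbits_funpow fun_eq_iff)

lemma code_orbit_in_Dhat: "u \<in> orbits \<Longrightarrow> code \<circ> u \<in> Dhat (itinerary 0)"
  by (simp add: Dhat_def proj_from_code_orbit itinerary_in_D) (simp add: itinerary_in_D orbits_def)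

lemma inj_on_code_orbits: "inj_on ((\<circ>) code) orbits"
proof (intro inj_onI ext)
  fix u v i assume uv: "u \<in> orbits" "v \<in> orbits" "code \<circ> u = code \<circ> v"
  then have "itinerary (u i) = itinerary (v i)"
    by (metis proj_from_code_orbit)
  then have "seq_compat (itinerary (u i)) (itinerary (v i))"
    by (simp add: seq_compat_def compat_def)
  then show "u i = v i"
    using uv by (intro itinerary_compat_imp_eq) (auto simp: orbits_def)
qed

lemma continuous_on_code_comp: "continuous_on A (\<lambda>u. code \<circ> u)" for A :: "(int \<Rightarrow> real) set"
proof (rule continuous_on_coordinatewise_then_product)
  fix i
  have "continuous_on A (\<lambda>u. u i)"
    by (rule continuous_on_subset[OF continuous_on_product_coordinates]) simp
  then show "continuous_on A (\<lambda>u. (code \<circ> u) i)"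
    using continuous_on_compose2[OF continuous_on_code] by auto
qed

lemma continuous_on_tent: "continuous_on UNIV tent"
  unfolding tent_def by (intro continuous_intros)

lemma compact_orbits: "compact orbits"
proof -
  have "compact (PiE UNIV (\<lambda>_::int. {-1..1::real}))"
    using compactin_PiE[of "\<lambda>_. euclidean" UNIV "\<lambda>_::int. {-1..1::real}"]
    by (simp add: euclidean_product_topology)
  moreover have "closed {u. tent (u i) = u (i + 1)}" for i
    by (intro closed_Collect_eq continuous_on_product_coordinates
        continuous_on_compose2[OF continuous_on_tent]) auto
  ultimately have "compact (PiE UNIV (\<lambda>_::int. {-1..1::real}) \<inter> (\<Inter>i. {u. tent (u i) = u (i + 1)}))"
    by (intro compact_Int_closed closed_INT) auto
  also have "\<dots> = orbits"
    by (auto simp: orbits_def PiE_def abs_le_iff; force)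
  finally show ?thesis .
qed

text \<open>An arbitrary compatible metric is not expressed by coordinates, so exact agreement of
  each coordinate is transferred by compactness: if the distance stayed above \<open>\<epsilon>\<close> along a sequence
  of times tending to infinity, subsequences of both orbits would converge to one and the same
  orbit, and by continuity of the coding both points would come within \<open>\<epsilon>/2\<close> of its image.\<close>
lemma code_asymptotic_of_coordinates_eventually_eq:
  fixes u v :: "real \<Rightarrow> int \<Rightarrow> real"
  assumes metric: "compatible_metric (itinerary 0) d"
    and u: "\<And>s. 0 \<le> s \<Longrightarrow> u s \<in> orbits" and v: "\<And>s. 0 \<le> s \<Longrightarrow> v s \<in> orbits"
    and agree: "\<And>i. \<forall>\<^sub>F s in at_top. u s i = v s i"
  shows "((\<lambda>s. d (code \<circ> u s) (code \<circ> v s)) \<longlongrightarrow> 0) at_top"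
proof (rule ccontr)
  interpret Metric_space "Dhat (itinerary 0)" d
    using metric by (simp add: compatible_metric_def)
  have top: "mtopology = top_of_set (Dhat (itinerary 0))"
    using metric by (simp add: compatible_metric_def)
  have conv: "\<forall>\<^sub>F n in sequentially. d (code \<circ> a) (code \<circ> w n) < \<epsilon>"
    if w: "\<And>n. w n \<in> orbits" and a: "a \<in> orbits" "w \<longlonglongrightarrow> a" and \<epsilon>: "0 < \<epsilon>" for w a \<epsilon>
  proof -
    have "openin (top_of_set (Dhat (itinerary 0))) (mball (code \<circ> a) \<epsilon>)"
      unfolding top[symmetric] by (rule openin_mball)
    then obtain U where U: "open U" "mball (code \<circ> a) \<epsilon> = Dhat (itinerary 0) \<inter> U"
      by (auto simp: openin_open)
    have "code \<circ> a \<in> U"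
      using U(2) a(1) \<epsilon> code_orbit_in_Dhat centre_in_mball_iff by blast
    moreover have "(\<lambda>n. code \<circ> w n) \<longlonglongrightarrow> (code \<circ> a)"
      using continuous_on_tendsto_compose[OF continuous_on_code_comp[of UNIV] a(2)] by simp
    ultimately have "\<forall>\<^sub>F n in sequentially. code \<circ> w n \<in> U"
      using U(1) by (simp add: topological_tendstoD)
    then show ?thesis
    proof eventually_elim
      case (elim n)
      then have "code \<circ> w n \<in> mball (code \<circ> a) \<epsilon>"
        using U(2) code_orbit_in_Dhat[OF w] by blast
      then show ?case by simp
    qed
  qed
  assume "\<not> ?thesis"
  then obtain \<epsilon> where \<epsilon>: "0 < \<epsilon>"
    "\<not> (\<forall>\<^sub>F s in at_top. dist (d (code \<circ> u s) (code \<circ> v s)) 0 < \<epsilon>)"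
    by (auto simp: tendsto_iff)
  then have "\<exists>s\<ge>real n. \<epsilon> \<le> d (code \<circ> u s) (code \<circ> v s)" for n
    by (force simp: eventually_at_top_linorder not_less)
  then obtain s where s: "\<And>n. real n \<le> s n" "\<And>n. \<epsilon> \<le> d (code \<circ> u (s n)) (code \<circ> v (s n))"
    by metis
  then have s0: "0 \<le> s n" for n using of_nat_0_le_iff order_trans by blast
  have seq: "seq_compact orbits"
    by (rule compact_imp_seq_compact[OF compact_orbits])
  obtain a r where a: "a \<in> orbits" "strict_mono r" "((\<lambda>n. u (s n)) \<circ> r) \<longlonglongrightarrow> a"
    using seq_compactE[OF seq, of "\<lambda>n. u (s n)"] u s0 by blast
  obtain b r' where b: "b \<in> orbits" "strict_mono r'" "((\<lambda>n. v (s (r n))) \<circ> r') \<longlonglongrightarrow> b"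
    using seq_compactE[OF seq, of "\<lambda>n. v (s (r n))"] v s0 by blast
  define q where "q = s \<circ> r \<circ> r'"
  have ua: "(\<lambda>n. u (q n)) \<longlonglongrightarrow> a"
    using LIMSEQ_subseq_LIMSEQ[OF a(3) b(2)] by (simp add: q_def o_def)
  have vb: "(\<lambda>n. v (q n)) \<longlonglongrightarrow> b"
    using b(3) by (simp add: q_def o_def)
  have "filterlim s at_top sequentially"
    using filterlim_at_top_mono[OF filterlim_real_sequentially] s(1) by simp
  then have q: "filterlim q at_top sequentially"
    using filterlim_compose[OF filterlim_compose[OF _ filterlim_subseq[OF a(2)]]
        filterlim_subseq[OF b(2)]] by (simp add: q_def o_def)
  have "a = b"
  proof
    fix i
    have coord: "(\<lambda>n. w n i) \<longlonglongrightarrow> c i" if "w \<longlonglongrightarrow> c" for w and c :: "int \<Rightarrow> real"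
      using continuous_on_tendsto_compose[OF continuous_on_product_coordinates that] by simp
    have "\<forall>\<^sub>F n in sequentially. u (q n) i = v (q n) i"
      by (rule eventually_compose_filterlim[OF agree q])
    then have "(\<lambda>n. v (q n) i) \<longlonglongrightarrow> a i"
      using coord[OF ua] by (simp add: tendsto_cong)
    then show "a i = b i"
      using coord[OF vb] LIMSEQ_unique by blast
  qed
  have "\<forall>\<^sub>F n in sequentially. d (code \<circ> a) (code \<circ> u (q n)) < \<epsilon> / 2"
    using conv[OF _ a(1) ua, of "\<epsilon> / 2"] u s0 \<epsilon>(1) by (simp add: q_def)
  moreover have "\<forall>\<^sub>F n in sequentially. d (code \<circ> a) (code \<circ> v (q n)) < \<epsilon> / 2"
    using conv[OF _ b(1) vb, of "\<epsilon> / 2"] v s0 \<epsilon>(1) by (simp add: q_def \<open>a = b\<close>)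
  ultimately have "\<forall>\<^sub>F n in sequentially. False"
  proof eventually_elim
    case (elim n)
    have "u (q n) \<in> orbits" "v (q n) \<in> orbits" using u v s0 by (simp_all add: q_def)
    then have "d (code \<circ> u (q n)) (code \<circ> v (q n))
        \<le> d (code \<circ> u (q n)) (code \<circ> a) + d (code \<circ> a) (code \<circ> v (q n))"
      using a(1) by (intro triangle code_orbit_in_Dhat)
    with elim s(2)[of "r (r' n)"] show ?case
      by (simp add: q_def commute)
  qed
  then show False by simp
qed

section \<open>Unstable rays of the periodic orbit\<close>

text \<open>\<open>bump r\<close> is the graph of slope \<open>\<plusminus>1\<close> with its maximum at \<open>\<lambda>\<^sup>r\<^sup>-\<^sup>m\<close>, normalized so that its
  right branch is \<open>1 - s\<close> for every \<open>r\<close>. This common branch is why the unstable rays agree later.\<close>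
definition bump :: "nat \<Rightarrow> real \<Rightarrow> real" where
  "bump r s = 1 - 1 / lam ^ (m - r) - \<bar>s - 1 / lam ^ (m - r)\<bar>"

text \<open>The unstable rays on \<open>[0, 1]\<close>. The value at \<open>0\<close> is the point of index \<open>j\<close> on the periodic orbit
  with word \<open>1 2\<^sup>m\<^sup>-\<^sup>2 1\<close>. Index \<open>0\<close> has the opposite sign because its turning value is the maximum \<open>\<lambda> - 1\<close>
  of the tent map, whereas those of the other indices are the negative points of the critical orbit.\<close>
definition germ :: "int \<Rightarrow> real \<Rightarrow> real" where
  "germ j s = (if j mod int m = 0 then bump 0 s else - bump (nat (j mod int m)) s)"

lemma tent_germ_eq: "tent (germ j s) = tent (bump (nat (j mod int m)) s)"
  by (simp add: germ_def tent_def)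

lemma bump_pos:
  assumes "Suc r < m" "0 \<le> s" "s \<le> 1"
  shows "0 \<le> bump r s"
proof -
  have "(9/4 :: real) = (3/2) ^ 2" by (simp add: power2_eq_square)
  also have "\<dots> \<le> lam ^ 2" using lam_ge by (intro power_mono) auto
  also have "\<dots> \<le> lam ^ (m - r)" using assms(1) lam_gt_1 by (intro power_increasing) auto
  finally have "1 / lam ^ (m - r) \<le> 1 / 2"
    by (intro divide_left_mono) auto
  then show ?thesis using assms by (simp add: bump_def)
qed

text \<open>For indices below \<open>m - 1\<close> the germ has constant sign, and the tent map scales its graph, moving
  the turning point by the factor \<open>\<lambda>\<close>. The germ of index \<open>m - 1\<close> changes sign at
  \<open>(2 - \<lambda>)/\<lambda> = \<lambda>\<^sup>-\<^sup>m\<^sup>-\<^sup>1\<close> before its own turning point at \<open>1/\<lambda>\<close>, and folding at this zero creates the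
  turning point \<open>\<lambda>\<^sup>-\<^sup>m\<close> of the germ of index \<open>0\<close>.\<close>
lemma tent_germ:
  assumes "0 \<le> s" "s \<le> 1"
  shows "tent (germ (j - 1) (s / lam)) = germ j s"
proof -
  define r where "r = nat ((j - 1) mod int m)"
  have m0: "0 < int m" using m_ge by simp
  have r: "(j - 1) mod int m = int r" "r < m"
    using m0 by (auto simp: r_def nat_less_iff)
  have jr: "j mod int m = (int r + 1) mod int m"
    using r(1) by (metis diff_add_cancel mod_add_left_eq)
  have s1: "s / lam \<le> 1 / lam" using assms lam_pos by (simp add: divide_right_mono)
  show ?thesis
  proof (cases "Suc r < m")
    case True
    then have "j mod int m = int (Suc r)" using jr by simp
    then have "germ j s = - bump (Suc r) s" by (simp add: germ_def del: of_nat_Suc)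
    moreover have "0 \<le> bump r (s / lam)"
      using True assms s1 lam_gt_1 by (intro bump_pos) (auto intro: order_trans)
    moreover have "lam * bump r (s / lam) = lam - 1 + bump (Suc r) s"
    proof -
      have "m - r = Suc (m - Suc r)" using True by simp
      then have eq: "lam * (1 / lam ^ (m - r)) = 1 / lam ^ (m - Suc r)"
        using lam_pos by simp
      have "lam * \<bar>s / lam - 1 / lam ^ (m - r)\<bar> = \<bar>lam * (s / lam - 1 / lam ^ (m - r))\<bar>"
        using lam_pos by (simp add: abs_mult)
      also have "\<dots> = \<bar>s - 1 / lam ^ (m - Suc r)\<bar>"
        using eq lam_pos by (simp add: right_diff_distrib)
      finally show ?thesis
        using eq by (simp add: bump_def right_diff_distrib)
    qed
    ultimately show ?thesis
      using r unfolding tent_germ_eq by (simp add: tent_def)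
  next
    case False
    with r have r_eq: "r = m - 1" "m - r = 1" using m_ge by auto
    then have "j mod int m = 0" using jr m_ge by (simp add: of_nat_diff)
    then have "germ j s = lam - 1 - \<bar>s - (2 - lam)\<bar>"
      by (simp add: germ_def bump_def two_minus_lam[symmetric])
    moreover have "bump r (s / lam) = 1 + s / lam - 2 / lam"
      using s1 r_eq by (simp add: bump_def)
    moreover have "lam * \<bar>1 + s / lam - 2 / lam\<bar> = \<bar>s - (2 - lam)\<bar>"
    proof -
      have "lam * (1 + s / lam - 2 / lam) = s - (2 - lam)"
        using lam_pos by (simp add: field_simps)
      then show ?thesis using lam_pos by (metis abs_mult abs_of_pos)
    qed
    ultimately show ?thesis
      using r unfolding tent_germ_eq by (simp add: tent_def)
  qed
qed

lemma tent_funpow_germ: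
  assumes "0 \<le> s" "s \<le> 1"
  shows "(tent ^^ n) (germ (j - int n) (s / lam ^ n)) = germ j s"
  using assms
proof (induction n arbitrary: j s)
  case (Suc n)
  have "s / lam \<le> 1" using Suc.prems lam_gt_1 by simp
  then have "(tent ^^ n) (germ (j - 1 - int n) (s / lam / lam ^ n)) = germ (j - 1) (s / lam)"
    using Suc.prems lam_pos by (intro Suc.IH) auto
  moreover have "j - 1 - int n = j - int (Suc n)" "s / lam / lam ^ n = s / lam ^ Suc n"
    by (auto simp: field_simps)
  ultimately show ?case using tent_germ[OF Suc.prems] by simp
qed simp

text \<open>The germs extended to \<open>[0, \<infinity>)\<close> by the functional equation. The least exponent merely picks
  one representation; by \<open>unstable_eq\<close> every sufficiently large exponent gives the same value.\<close>
definition unstable :: "int \<Rightarrow> real \<Rightarrow> real" where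
  "unstable j s = (let n = (LEAST n. s \<le> lam ^ n) in (tent ^^ n) (germ (j - int n) (s / lam ^ n)))"

lemma unstable_eq:
  assumes "0 \<le> s" "s \<le> lam ^ n"
  shows "unstable j s = (tent ^^ n) (germ (j - int n) (s / lam ^ n))"
proof -
  define k where "k = (LEAST n. s \<le> lam ^ n)"
  have k: "s \<le> lam ^ k" "k \<le> n"
    unfolding k_def using assms(2) by (auto intro: LeastI Least_le)
  then obtain c where n: "n = k + c" by (auto simp: le_iff_add)
  have "(tent ^^ c) (germ (j - int k - int c) (s / lam ^ k / lam ^ c)) = germ (j - int k) (s / lam ^ k)"
    using assms(1) k(1) lam_pos by (intro tent_funpow_germ) auto
  moreover have "j - int n = j - int k - int c" "s / lam ^ n = s / lam ^ k / lam ^ c"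
    by (simp_all add: n power_add)
  moreover have "tent ^^ n = tent ^^ k \<circ> tent ^^ c"
    by (simp add: n funpow_add)
  ultimately have "(tent ^^ n) (germ (j - int n) (s / lam ^ n)) = (tent ^^ k) (germ (j - int k) (s / lam ^ k))"
    by (simp only: o_apply)
  then show ?thesis
    by (simp only: unstable_def k_def[symmetric] Let_def)
qed

lemma unstable_eq_germ: "0 \<le> s \<Longrightarrow> s \<le> 1 \<Longrightarrow> unstable j s = germ j s"
  using unstable_eq[of s 0] by simp

lemma bounded_by_lam_power: obtains n where "s \<le> lam ^ n"
  using real_arch_pow[OF lam_gt_1, of s] less_imp_le by blast

lemma tent_unstable:
  assumes "0 \<le> s"
  shows "tent (unstable (j - 1) (s / lam)) = unstable j s"
proof -
  obtain n where n: "s / lam \<le> lam ^ n" by (rule bounded_by_lam_power)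
  then have "s \<le> lam ^ Suc n" using lam_pos by (simp add: field_simps)
  then have "unstable j s = (tent ^^ Suc n) (germ (j - int (Suc n)) (s / lam ^ Suc n))"
    by (intro unstable_eq assms)
  also have "\<dots> = tent ((tent ^^ n) (germ (j - 1 - int n) (s / lam / lam ^ n)))"
    by (simp add: algebra_simps)
  also have "\<dots> = tent (unstable (j - 1) (s / lam))"
    using unstable_eq[OF _ n] assms lam_pos by simp
  finally show ?thesis ..
qed

lemma unstable_in_interval:
  assumes "0 \<le> s"
  shows "\<bar>unstable j s\<bar> \<le> 1"
proof -
  have bump: "\<bar>bump r t\<bar> \<le> 1" if "0 \<le> t" "t \<le> 1" for r t
  proof -
    have "0 \<le> 1 / lam ^ (m - r)" "1 / lam ^ (m - r) \<le> 1" using lam_gt_1 by auto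
    then show ?thesis using that unfolding bump_def by linarith
  qed
  obtain n where "s \<le> lam ^ n" by (rule bounded_by_lam_power)
  then show ?thesis
    using assms bump lam_pos
    by (subst unstable_eq) (auto intro!: tent_funpow_in_interval simp: germ_def)
qed

text \<open>The \<open>\<lambda>\<^sup>n\<close>-fold stretching by \<open>n\<close> tent steps is undone by the division of the argument by
  \<open>\<lambda>\<^sup>n\<close>.\<close>
lemma unstable_lipschitz:
  assumes "0 \<le> s" "0 \<le> t"
  shows "\<bar>unstable j s - unstable j t\<bar> \<le> \<bar>s - t\<bar>"
proof -
  obtain n where "max s t \<le> lam ^ n" by (rule bounded_by_lam_power)
  then have n: "s \<le> lam ^ n" "t \<le> lam ^ n" by auto
  have "\<bar>tent x - tent y\<bar> \<le> lam * \<bar>x - y\<bar>" for x y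
  proof -
    have "\<bar>tent x - tent y\<bar> = lam * \<bar>\<bar>y\<bar> - \<bar>x\<bar>\<bar>"
      using lam_pos by (simp add: tent_def abs_mult flip: right_diff_distrib)
    also have "\<dots> \<le> lam * \<bar>x - y\<bar>" using lam_pos by (intro mult_left_mono) auto
    finally show ?thesis .
  qed
  then have tent_n: "\<bar>(tent ^^ k) x - (tent ^^ k) y\<bar> \<le> lam ^ k * \<bar>x - y\<bar>" for k x y
  proof (induction k)
    case (Suc k)
    have "lam * \<bar>(tent ^^ k) x - (tent ^^ k) y\<bar> \<le> lam * (lam ^ k * \<bar>x - y\<bar>)"
      using Suc lam_pos by (intro mult_left_mono) auto
    with Suc.prems[of "(tent ^^ k) x" "(tent ^^ k) y"] show ?case by simp
  qed simp
  have "\<bar>germ i x - germ i y\<bar> \<le> \<bar>x - y\<bar>" for i x y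
  proof -
    have "\<bar>bump r x - bump r y\<bar> \<le> \<bar>x - y\<bar>" for r
      unfolding bump_def by linarith
    then show ?thesis by (simp add: germ_def abs_minus_commute)
  qed
  then have "lam ^ n * \<bar>germ (j - int n) (s / lam ^ n) - germ (j - int n) (t / lam ^ n)\<bar>
      \<le> lam ^ n * \<bar>s / lam ^ n - t / lam ^ n\<bar>"
    using lam_pos by (intro mult_left_mono) auto
  also have "\<dots> = \<bar>s - t\<bar>"
    using lam_pos by (simp add: abs_divide flip: diff_divide_distrib)
  finally show ?thesis
    using order_trans[OF tent_n] unfolding unstable_eq[OF assms(1) n(1)] unstable_eq[OF assms(2) n(2)]
    by blast
qed

lemma unstable_inj_near_0:
  assumes "0 \<le> s" "s \<le> 1 / lam ^ m" "0 \<le> t" "t \<le> 1 / lam ^ m" "unstable j s = unstable j t"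
  shows "s = t"
proof -
  have bump: "bump r x = 1 - 2 / lam ^ (m - r) + x" if "x \<le> 1 / lam ^ m" for r x
  proof -
    have "1 / lam ^ m \<le> 1 / lam ^ (m - r)"
      using lam_gt_1 by (intro divide_left_mono power_increasing) auto
    with that show ?thesis by (simp add: bump_def)
  qed
  have "1 / lam ^ m \<le> 1" using lam_gt_1 by simp
  then have "germ j s = germ j t" using assms by (simp add: unstable_eq_germ)
  then show ?thesis using assms by (simp add: germ_def bump split: if_splits)
qed

text \<open>The argument \<open>s/\<lambda>\<close> lies in \<open>[1/\<lambda>, 1]\<close>, to the right of every turning point \<open>\<lambda>\<^sup>r\<^sup>-\<^sup>m\<close>, where all
  germs equal \<open>\<plusminus>(1 - s/\<lambda>)\<close>; the tent map removes the sign.\<close>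
lemma unstable_1_lam:
  assumes "1 \<le> s" "s \<le> lam"
  shows "unstable j s = s - 1"
proof -
  define r where "r = nat ((j - 1) mod int m)"
  have "r < m" using m_ge by (simp add: r_def nat_less_iff)
  have s: "1 / lam \<le> s / lam" "s / lam \<le> 1"
    using assms lam_pos by (auto simp: divide_right_mono)
  have "lam ^ 1 \<le> lam ^ (m - r)" using \<open>r < m\<close> lam_gt_1 by (intro power_increasing) auto
  then have "1 / lam ^ (m - r) \<le> 1 / lam"
    using lam_pos by (intro divide_left_mono) auto
  then have "bump r (s / lam) = 1 - s / lam"
    using s by (simp add: bump_def)
  moreover have "tent (1 - s / lam) = s - 1"
    using s lam_pos by (simp add: tent_def right_diff_distrib)
  ultimately have "tent (germ (j - 1) (s / lam)) = s - 1"
    unfolding tent_germ_eq r_def[symmetric] by (simp only:)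
  moreover have "unstable (j - 1) (s / lam) = germ (j - 1) (s / lam)"
    using s assms lam_pos by (intro unstable_eq_germ) auto
  moreover have "tent (unstable (j - 1) (s / lam)) = unstable j s"
    using assms by (intro tent_unstable) auto
  ultimately show ?thesis by (simp only:)
qed

text \<open>This is the source of asymptoticity: \<open>[1, \<lambda>]\<close> is a fundamental domain for \<open>s \<mapsto> \<lambda> s\<close> on
  \<open>[1, \<infinity>)\<close>, so the functional equation propagates the agreement there to all larger arguments.\<close>
lemma unstable_agree:
  assumes "1 \<le> s"
  shows "unstable i s = unstable j s"
proof -
  have "unstable i s = unstable j s" if "1 \<le> s" "s \<le> lam ^ n" for n i j s
    using that
  proof (induction n arbitrary: i j s)
    case 0
    then have "s \<le> lam" using lam_gt_1 by simp
    with 0 show ?case by (simp add: unstable_1_lam)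
  next
    case (Suc n)
    show ?case
    proof (cases "s \<le> lam")
      case True
      with Suc.prems show ?thesis by (simp add: unstable_1_lam)
    next
      case False
      then have "unstable (i - 1) (s / lam) = unstable (j - 1) (s / lam)"
        using Suc.prems lam_pos by (intro Suc.IH) (auto simp: field_simps)
      then show ?thesis
        using tent_unstable[of s i] tent_unstable[of s j] Suc.prems(1) by simp
    qed
  qed
  moreover obtain n where "s \<le> lam ^ n" by (rule bounded_by_lam_power)
  ultimately show ?thesis using assms by blast
qed

section \<open>The asymptotic rays\<close>

text \<open>The parameter is normalized so that the coordinate of index \<open>-1\<close> starts at the argument \<open>1\<close>,
  where every unstable ray is at the critical point \<open>0\<close>; the arguments of all earlier
  coordinates then start in \<open>[0, 1]\<close>, where the germs describe them.\<close>
definition orbit_ray :: "nat \<Rightarrow> real \<Rightarrow> int \<Rightarrow> real" where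
  "orbit_ray l t i = unstable (i + 1 + int l) (lam powi (i + 1) * (1 + t))"

lemma orbit_ray_in_orbits: "0 \<le> t \<Longrightarrow> orbit_ray l t \<in> orbits"
proof -
  assume t: "0 \<le> t"
  have "tent (orbit_ray l t i) = orbit_ray l t (i + 1)" for i
  proof -
    have "lam powi (i + 1 + 1) = lam powi (i + 1) * lam"
      using lam_pos by (intro power_int_add_1) auto
    then have s: "lam powi (i + 1) * (1 + t) = lam powi (i + 1 + 1) * (1 + t) / lam"
      using lam_pos by simp
    have j: "i + 1 + int l = i + 1 + 1 + int l - 1" by simp
    have "0 \<le> lam powi (i + 1 + 1) * (1 + t)" using t lam_pos by simp
    then show ?thesis
      unfolding orbit_ray_def s j by (rule tent_unstable)
  qed
  then show ?thesis
    using t lam_pos by (auto simp: orbits_def orbit_ray_def intro!: unstable_in_interval)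
qed

lemma continuous_on_orbit_ray: "continuous_on {0..} (orbit_ray l)"
proof (rule continuous_on_coordinatewise_then_product)
  fix i
  have "1-lipschitz_on {0..} (unstable j)" for j
    by (rule lipschitz_onI) (auto simp: dist_real_def unstable_lipschitz)
  then have "continuous_on {0..} (unstable (i + 1 + int l))"
    using lipschitz_on_continuous_on by blast
  moreover have "continuous_on {0..} (\<lambda>t. lam powi (i + 1) * (1 + t))"
    by (intro continuous_intros)
  moreover have "(\<lambda>t. lam powi (i + 1) * (1 + t)) ` {0..} \<subseteq> {0..}"
    using lam_pos by auto
  ultimately show "continuous_on {0..} (\<lambda>t. orbit_ray l t i)"
    unfolding orbit_ray_def by (rule continuous_on_compose2)
qed

text \<open>A coordinate far enough in the past sees both parameters before its first turning point.\<close>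
lemma inj_on_orbit_ray: "inj_on (orbit_ray l) {0..}"
proof (rule inj_onI)
  fix s t :: real
  assume st: "s \<in> {0..}" "t \<in> {0..}" "orbit_ray l s = orbit_ray l t"
  obtain n where n: "1 + max s t \<le> lam ^ n" by (rule bounded_by_lam_power)
  define i where "i = - int (n + m) - 1"
  define c where "c = lam powi (i + 1)"
  have "c = inverse (lam ^ (n + m))"
    unfolding c_def i_def by (simp only: diff_add_cancel power_int_minus power_int_of_nat)
  then have c: "c = 1 / lam ^ n / lam ^ m"
    by (simp add: power_add divide_inverse)
  have small: "0 \<le> c * (1 + x)" "c * (1 + x) \<le> 1 / lam ^ m" if "0 \<le> x" "1 + x \<le> lam ^ n" for x
  proof -
    have "(1 + x) / lam ^ n \<le> 1" using that(2) lam_pos by simp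
    then have "(1 + x) / lam ^ n / lam ^ m \<le> 1 / lam ^ m"
      using lam_pos by (intro divide_right_mono) simp_all
    then show "c * (1 + x) \<le> 1 / lam ^ m" by (simp add: c)
    show "0 \<le> c * (1 + x)" using that(1) lam_pos by (simp add: c)
  qed
  have "unstable (i + 1 + int l) (c * (1 + s)) = unstable (i + 1 + int l) (c * (1 + t))"
    using fun_cong[OF st(3), of i] unfolding orbit_ray_def c_def .
  moreover have "0 \<le> s" "1 + s \<le> lam ^ n" "0 \<le> t" "1 + t \<le> lam ^ n"
    using st(1,2) n by auto
  ultimately have "c * (1 + s) = c * (1 + t)"
    using unstable_inj_near_0 small by meson
  moreover have "c \<noteq> 0" using lam_pos by (simp add: c)
  ultimately show "s = t" by simp
qed

lemma orbit_rays_eventually_eq: "\<forall>\<^sub>F t in at_top. orbit_ray k t i = orbit_ray l t i"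
proof -
  have "\<forall>\<^sub>F t in at_top. 1 / lam powi (i + 1) \<le> t"
    by (rule eventually_ge_at_top)
  then show ?thesis
  proof eventually_elim
    case (elim t)
    have "1 / lam powi (i + 1) \<le> 1 + t" using elim by simp
    moreover have "0 < lam powi (i + 1)" using lam_pos by simp
    ultimately have "1 \<le> lam powi (i + 1) * (1 + t)"
      by (simp add: pos_divide_le_eq mult.commute)
    then show ?case unfolding orbit_ray_def by (rule unstable_agree)
  qed
qed

lemma parameterization_orbit_ray:
  "parameterization (itinerary 0) ((\<lambda>t. code \<circ> orbit_ray l t) ` {0..}) (code \<circ> orbit_ray l 0)
     (\<lambda>t. code \<circ> orbit_ray l t)"
proof -
  have "continuous_on {0..} (\<lambda>t. code \<circ> orbit_ray l t)"
    by (rule continuous_on_compose2[OF continuous_on_code_comp[of UNIV] continuous_on_orbit_ray]) simp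
  moreover have "inj_on (\<lambda>t. code \<circ> orbit_ray l t) {0..}"
  proof (rule inj_onI)
    fix s t :: real
    assume st: "s \<in> {0..}" "t \<in> {0..}" "code \<circ> orbit_ray l s = code \<circ> orbit_ray l t"
    then have "orbit_ray l s = orbit_ray l t"
      by (intro inj_onD[OF inj_on_code_orbits] orbit_ray_in_orbits) auto
    with st show "s = t" by (intro inj_onD[OF inj_on_orbit_ray])
  qed
  ultimately show ?thesis
    by (auto simp: parameterization_def intro: code_orbit_in_Dhat orbit_ray_in_orbits)
qed

text \<open>Only the germ of index \<open>m - 1\<close> takes both signs at the points \<open>\<lambda>\<^sup>-\<^sup>k\<close>. Its zero in \<open>(0, 1)\<close> is
  \<open>(2 - \<lambda>)/\<lambda> = \<lambda>\<^sup>-\<^sup>m\<^sup>-\<^sup>1\<close>, so the change occurs exactly at \<open>k = m + 1\<close>, where either letter is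
  compatible.\<close>
lemma germ_sign:
  fixes j :: int and k :: nat
  defines "r \<equiv> j mod int m"
  shows "r = 0 \<Longrightarrow> 0 \<le> germ j (1 / lam ^ k)"
    and "r \<noteq> 0 \<Longrightarrow> r \<noteq> int m - 1 \<Longrightarrow> germ j (1 / lam ^ k) \<le> 0"
    and "r = int m - 1 \<Longrightarrow> k \<le> m + 1 \<Longrightarrow> germ j (1 / lam ^ k) \<le> 0"
    and "r = int m - 1 \<Longrightarrow> m + 1 \<le> k \<Longrightarrow> 0 \<le> germ j (1 / lam ^ k)"
proof -
  let ?s = "1 / lam ^ k"
  have s: "0 \<le> ?s" "?s \<le> 1" using lam_gt_1 by auto
  have r: "0 \<le> r" "r < int m" using m_ge by (auto simp: r_def)
  show "0 \<le> germ j ?s" if "r = 0"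
    using that m_ge s by (simp add: germ_def r_def bump_pos)
  show "germ j ?s \<le> 0" if "r \<noteq> 0" "r \<noteq> int m - 1"
    using that r s bump_pos[of "nat r" ?s] by (simp add: germ_def r_def[symmetric])
  have last: "germ j ?s = - bump (m - 1) ?s" if "r = int m - 1"
    using that m_ge by (simp add: germ_def r_def[symmetric] nat_diff_distrib)
  have bump: "bump (m - 1) ?s = min (1 - ?s) (?s - 1 / lam ^ (m + 1))"
  proof -
    have "1 - 2 / lam = - ((2 - lam) / lam)" using lam_pos by (simp add: field_simps)
    also have "\<dots> = - (1 / lam ^ (m + 1))" by (simp add: two_minus_lam mult.commute)
    finally have "1 - 2 / lam = - (1 / lam ^ (m + 1))" .
    moreover have "m - (m - 1) = 1" using m_ge by simp
    ultimately show ?thesis by (simp add: bump_def min_def abs_if)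
  qed
  show "germ j ?s \<le> 0" if "r = int m - 1" "k \<le> m + 1"
  proof -
    have "1 / lam ^ (m + 1) \<le> ?s"
      using that lam_gt_1 by (intro divide_left_mono power_increasing) auto
    then show ?thesis using s last[OF that(1)] bump by (simp add: min_def)
  qed
  show "0 \<le> germ j ?s" if "r = int m - 1" "m + 1 \<le> k"
  proof -
    have "?s \<le> 1 / lam ^ (m + 1)"
      using that lam_gt_1 by (intro divide_left_mono power_increasing) auto
    then show ?thesis using s last[OF that(1)] bump by (simp add: min_def)
  qed
qed

text \<open>The coordinate of index \<open>-1-k\<close> starts at \<open>\<lambda>\<^sup>-\<^sup>k\<close> on the unstable ray of index \<open>l - k\<close>. Far in the
  past its sign follows the periodic word; in the last \<open>m + 1 + l\<close> letters
  the germ of index \<open>m - 1\<close> has already crossed \<open>0\<close>, so that \<open>Two\<close> replaces the periodic letter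
  \<open>One\<close> there, and \<open>1 2\<^sup>m\<^sup>-\<^sup>2 1\<close> becomes \<open>1 2\<^sup>m\<^sup>-\<^sup>1\<close>.\<close>
lemma orbit_ray_origin:
  assumes "l < m"
  shows "code \<circ> orbit_ray l 0 \<in> T (itinerary 0)
    (left_periodic ([One] @ replicate (m - 2) Two @ [One])
       ([One] @ replicate (m - 1) Two @ [One] @ replicate l Two))"
proof -
  let ?w = "[One] @ replicate (m - 2) Two @ [One]"
  let ?v = "[One] @ replicate (m - 1) Two @ [One] @ replicate l Two"
  have "code (orbit_ray l 0 i) \<approx>\<^sub>s left_periodic ?w ?v i" if "i \<le> -1" for i
  proof -
    define k where "k = nat (- 1 - i)"
    have i: "i = - 1 - int k" using that by (simp add: k_def)
    let ?L = "left_periodic ?w ?v i" and ?r = "(int l - int k) mod int m"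
    have "orbit_ray l 0 i = unstable (int l - int k) (1 / lam ^ k)"
      by (simp add: orbit_ray_def i power_int_minus field_simps)
    also have "\<dots> = germ (int l - int k) (1 / lam ^ k)"
      using lam_gt_1 by (intro unstable_eq_germ) auto
    finally have ray: "orbit_ray l 0 i = germ (int l - int k) (1 / lam ^ k)" .
    have rev: "rev ?w = ?w" "rev ?v = replicate l Two @ [One] @ replicate (m - 1) Two @ [One]"
      by simp_all
    have len: "length ?w = m" "length ?v = l + m + 1" using m_ge by auto
    have L: "?L = (if k < l + m + 1 then rev ?v ! k else ?w ! ((k - (l + m + 1)) mod m))"
      unfolding left_periodic_def Let_def rev(1) len k_def by simp
    \<comment> \<open>At \<open>k = m + 1\<close> the residue \<open>m - 1\<close> may carry either letter, so the conditions of the two cases overlap there.\<close>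
    have "(?L = One \<and> (?r = 0 \<or> ?r = int m - 1 \<and> m + 1 \<le> k)) \<or>
          (?L = Two \<and> ?r \<noteq> 0 \<and> (?r = int m - 1 \<longrightarrow> k \<le> m + 1))"
    proof -
      consider "k < l" | "k = l" | "l < k" "k < l + m" | "k = l + m" | "l + m + 1 \<le> k" by linarith
      then show ?thesis
      proof cases
        case 1
        then have "?r = int l - int k" using assms by simp
        moreover have "?L = Two" using 1 unfolding L rev(2) by (simp add: nth_append)
        ultimately show ?thesis using 1 assms by simp
      next
        case 2
        then show ?thesis unfolding L rev(2) by (simp add: nth_append)
      next
        case 3
        have "?r = (int l - int k + int m) mod int m" by simp
        also have "\<dots> = int l - int k + int m" using 3 by (intro mod_pos_pos_trivial) auto
        finally have "?r = int l - int k + int m" .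
        moreover have "?L = Two"
          using 3 unfolding L rev(2) by (auto simp: nth_append nth_Cons split: nat.splits)
        ultimately show ?thesis using 3 assms by auto
      next
        case 4
        have "?L = One"
          using 4 m_ge unfolding L rev(2) by (auto simp: nth_append nth_Cons split: nat.splits)
        then show ?thesis using 4 by simp
      next
        case 5
        \<comment> \<open>\<open>q\<close> is the position in \<open>w\<close> read from the right, which is the same as from the left since
          \<open>w\<close> is a palindrome.\<close>
        define q c where "q = (k - (l + m + 1)) mod m" and "c = (k - (l + m + 1)) div m"
        have "q < m" using m_ge by (simp add: q_def)
        have "k = l + m + 1 + (c * m + q)" using 5 by (simp add: q_def c_def)
        then have "int l - int k = (int m - 1 - int q) + (- int c - 2) * int m"
          by (simp add: algebra_simps)
        then have "?r = (int m - 1 - int q) mod int m" by (metis mod_mult_self1)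
        also have "\<dots> = int m - 1 - int q"
          using \<open>q < m\<close> by (intro mod_pos_pos_trivial) auto
        finally have r: "?r = int m - 1 - int q" .
        have "?L = ?w ! q" using 5 unfolding L q_def by simp
        also have "?w ! q = (if q = 0 \<or> q = m - 1 then One else Two)"
          using \<open>q < m\<close> m_ge by (auto simp: nth_append nth_Cons split: nat.splits)
        finally show ?thesis using r 5 \<open>q < m\<close> by auto
      qed
    qed
    then show ?thesis
      unfolding ray
      using germ_sign[of "int l - int k" k] compat_code_One compat_code_Two by metis
  qed
  then show ?thesis
    by (simp add: T_def code_orbit_in_Dhat orbit_ray_in_orbits)
qed

end

theorem theorem4p2:
  fixes N l :: nat
    and \<tau> :: "nat \<Rightarrow> symb"
    and e e' :: "int \<Rightarrow> symb"
    and d :: "(int \<Rightarrow> symb) \<Rightarrow> (int \<Rightarrow> symb) \<Rightarrow> real"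
  assumes "l \<in> {1..N - 2}"
    and "\<tau> = right_periodic ([Star, One] @ replicate (N - 2) Two)"
    and "e = left_periodic ([One] @ replicate (N - 3) Two @ [One])
               ([One] @ replicate (N - 2) Two @ [One])"
    and "e' = left_periodic ([One] @ replicate (N - 3) Two @ [One])
               ([One] @ replicate (N - 2) Two @ [One] @ replicate l Two)"
    and "compatible_metric \<tau> d"
  shows "\<exists>\<Phi> p \<Phi>' p'. ray \<tau> \<Phi> p \<and> ray \<tau> \<Phi>' p' \<and> asymptotic \<tau> d \<Phi> p \<Phi>' p' \<and>
           p \<in> T \<tau> e \<and> p' \<in> T \<tau> e'"
proof -
  define m where "m = N - 1"
  have m: "2 \<le> m" "N - 2 = m - 1" "N - 3 = m - 2" "l < m"
    using assms(1) by (auto simp: m_def)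
  obtain lam :: real where "3/2 \<le> lam" "lam < 2" "lam ^ m * (2 - lam) = 1"
    using exists_multinacci_slope[OF m(1)] by blast
  then interpret multinacci_tent m lam
    by unfold_locales (use m in auto)
  have \<tau>: "\<tau> = itinerary 0" using assms(2) m by (simp add: itinerary_0)
  let ?\<phi> = "\<lambda>k t. code \<circ> orbit_ray k t"
  have param: "parameterization \<tau> (?\<phi> k ` {0..}) (?\<phi> k 0) (?\<phi> k)" for k
    unfolding \<tau> by (rule parameterization_orbit_ray)
  have "((\<lambda>t. d (?\<phi> 0 t) (?\<phi> l t)) \<longlongrightarrow> 0) at_top"
    using assms(5) unfolding \<tau>
    by (rule code_asymptotic_of_coordinates_eventually_eq)
       (auto intro: orbit_ray_in_orbits orbit_rays_eventually_eq)
  then have "asymptotic \<tau> d (?\<phi> 0 ` {0..}) (?\<phi> 0 0) (?\<phi> l ` {0..}) (?\<phi> l 0)"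
    unfolding asymptotic_def using param by blast
  moreover have "?\<phi> 0 0 \<in> T \<tau> e"
    using orbit_ray_origin[of 0] m assms(3) by (simp add: \<tau>)
  moreover have "?\<phi> l 0 \<in> T \<tau> e'"
    using orbit_ray_origin[of l] m assms(4) by (simp add: \<tau>)
  ultimately show ?thesis
    unfolding ray_def using param by blast
qed

end
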